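(* Suppose that $\alpha\in\mathbb{R}$ is such that $$\mathsf{P}\left(\lim_{t\uparrow T}\int_0^t\frac{b(s)^2(X_s^{(\alpha)})^2}{\sigma(s)^2}\,\mathrm{d}s=\infty\right)=1.$$ Then the maximum likelihood estimator $\widehat{\alpha}_t^{(X^{(\alpha)})}$ of $\alpha$ is strongly consistent, i.e., $$\mathsf{P}\Big(\lim_{t\uparrow T}\widehat{\alpha}_t^{(X^{(\alpha)})}=\alpha\Big)=1.$$
   Context: Let $T\in(0,\infty]$ be fixed. Let $b:[0,T)\to\mathbb{R}$ and $\sigma:[0,T)\to\mathbb{R}$ be continuous functions such that $\sigma(t)>0$ for all $t\in[0,T)$, and there exists $t_0\in(0,T)$ with $b(t)\neq0$ for all $t\in[t_0,T)$. Let $(B_t)_{t\in[0,T)}$ be a standard Wiener process on a filtered probability space $(\Omega,\mathcal{F},(\mathcal{F}_t)_{t\in[0,T)},\mathsf{P})$ constructed with the help of $B$, satisfying the usual conditions, with $\mathcal{F}=\sigma\big(\bigcup_{t\in[0,T)}\mathcal{F}_t\big)$. For $\alpha\in\mathbb{R}$, let $(X_t^{(\alpha)})_{t\in[0,T)}$ be the unique strong solution of $$\mathrm{d}X_t^{(\alpha)}=\alpha b(t)X_t^{(\alpha)}\,\mathrm{d}t+\sigma(t)\,\mathrm{d}B_t,\quad t\in[0,T),\qquad X_0^{(\alpha)}=0,$$ that is, $X_t^{(\alpha)}=\int_0^t\sigma(s)\exp\{\alpha\int_s^t b(u)\,\mathrm{d}u\}\,\mathrm{d}B_s$. The maximum likelihood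 estimator (MLE) $\widehat{\alpha}_t^{(X^{(\alpha)})}$ of $\alpha$ based on $(X_s^{(\alpha)})_{s\in[0,t]}$ is the maximizer over $\theta\in\mathbb{R}$ of the log-likelihood $\theta\int_0^t\frac{b(s)X_s^{(\alpha)}}{\sigma(s)^2}\,\mathrm{d}X_s^{(\alpha)}-\frac{\theta^2}{2}\int_0^t\frac{b(s)^2(X_s^{(\alpha)})^2}{\sigma(s)^2}\,\mathrm{d}s$; for $t\in[t_0,T)$ it exists $\mathsf{P}$-almost surely, is unique, and is given by $$\widehat{\alpha}_t^{(X^{(\alpha)})}=\frac{\int_0^t\frac{b(s)X_s^{(\alpha)}}{\sigma(s)^2}\,\mathrm{d}X_s^{(\alpha)}}{\int_0^t\frac{b(s)^2(X_s^{(\alpha)})^2}{\sigma(s)^2}\,\mathrm{d}s},\quad\text{so that}\quad \widehat{\alpha}_t^{(X^{(\alpha)})}-\alpha=\frac{\int_0^t\frac{b(s)X_s^{(\alpha)}}{\sigma(s)}\,\mathrm{d}B_s}{\int_0^t\frac{b(s)^2(X_s^{(\alpha)})^2}{\sigma(s)^2}\,\mathrm{d}s}.$$ *)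

theory Defs
  imports "HOL-Probability.Probability"
begin

text \<open>Processes are indexed by \<^typ>\<open>real\<close>; only their values at times in \<open>[0,T)\<close>, with
  \<open>T\<close> possibly infinite, are ever constrained or used.\<close>

definition time_set :: "ereal \<Rightarrow> real set" where
  "time_set T = {t. 0 \<le> t \<and> ereal t < T}"

definition filtration_on :: "'a measure \<Rightarrow> ereal \<Rightarrow> (real \<Rightarrow> 'a measure) \<Rightarrow> bool" where
  "filtration_on M T F \<longleftrightarrow>
     (\<forall>t\<in>time_set T. subalgebra M (F t)) \<and>
     (\<forall>s\<in>time_set T. \<forall>t\<in>time_set T. s \<le> t \<longrightarrow> sets (F s) \<subseteq> sets (F t))"

definition usual_conditions :: "'a measure \<Rightarrow> ereal \<Rightarrow> (real \<Rightarrow> 'a measure) \<Rightarrow> bool" where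
  "usual_conditions M T F \<longleftrightarrow>
     filtration_on M T F \<and> complete_measure M \<and>
     null_sets M \<subseteq> sets (F 0) \<and>
     (\<forall>t\<in>time_set T. sets (F t) = (\<Inter>u\<in>{u\<in>time_set T. t < u}. sets (F u)))"

definition augmented_natural_filtration ::
  "'a measure \<Rightarrow> (real \<Rightarrow> 'a \<Rightarrow> real) \<Rightarrow> real \<Rightarrow> 'a measure" where
  "augmented_natural_filtration M B t =
     sigma (space M)
       ({B s -` A \<inter> space M | s A. 0 \<le> s \<and> s \<le> t \<and> A \<in> sets borel} \<union> null_sets M)"

definition adapted :: "ereal \<Rightarrow> (real \<Rightarrow> 'a measure) \<Rightarrow> (real \<Rightarrow> 'a \<Rightarrow> real) \<Rightarrow> bool" where
  "adapted T F X \<longleftrightarrow> (\<forall>t\<in>time_set T. X t \<in> borel_measurable (F t))"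

definition progressive :: "ereal \<Rightarrow> (real \<Rightarrow> 'a measure) \<Rightarrow> (real \<Rightarrow> 'a \<Rightarrow> real) \<Rightarrow> bool" where
  "progressive T F H \<longleftrightarrow>
     (\<forall>t\<in>time_set T. (\<lambda>(s, \<omega>). H s \<omega>) \<in> borel_measurable (restrict_space borel {0..t} \<Otimes>\<^sub>M F t))"

definition continuous_process :: "'a measure \<Rightarrow> ereal \<Rightarrow> (real \<Rightarrow> 'a \<Rightarrow> real) \<Rightarrow> bool" where
  "continuous_process M T X \<longleftrightarrow> (\<forall>\<omega>\<in>space M. continuous_on (time_set T) (\<lambda>t. X t \<omega>))"

definition wiener_process ::
  "'a measure \<Rightarrow> ereal \<Rightarrow> (real \<Rightarrow> 'a measure) \<Rightarrow> (real \<Rightarrow> 'a \<Rightarrow> real) \<Rightarrow> bool" where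
  "wiener_process M T F B \<longleftrightarrow>
     adapted T F B \<and>
     (AE \<omega> in M. B 0 \<omega> = 0) \<and>
     (AE \<omega> in M. continuous_on (time_set T) (\<lambda>t. B t \<omega>)) \<and>
     (\<forall>s\<in>time_set T. \<forall>t\<in>time_set T. s < t \<longrightarrow>
        distributed M lborel (\<lambda>\<omega>. B t \<omega> - B s \<omega>) (\<lambda>x. ennreal (normal_density 0 (sqrt (t - s)) x)) \<and>
        prob_space.indep_set M (sets (F s))
          {(\<lambda>\<omega>. B t \<omega> - B s \<omega>) -` A \<inter> space M | A. A \<in> sets borel})"

definition tendsto_in_prob ::
  "'a measure \<Rightarrow> (nat \<Rightarrow> 'a \<Rightarrow> real) \<Rightarrow> ('a \<Rightarrow> real) \<Rightarrow> bool" where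
  "tendsto_in_prob M Z Y \<longleftrightarrow>
     (\<forall>n. Z n \<in> borel_measurable M) \<and> Y \<in> borel_measurable M \<and>
     (\<forall>\<epsilon>>0. (\<lambda>n. measure M {\<omega>\<in>space M. \<bar>Z n \<omega> - Y \<omega>\<bar> > \<epsilon>}) \<longlonglongrightarrow> 0)"

text \<open>The triple \<open>k, \<tau>, \<xi>\<close> encodes the simple process
  \<open>\<Sum>i<k. \<xi>\<^sub>i 1\<^bsub>(\<tau>\<^sub>i, \<tau>\<^sub>i\<^sub>+\<^sub>1]\<^esub>\<close> with bounded, \<open>F\<^bsub>\<tau>\<^sub>i\<^esub>\<close>-measurable heights \<open>\<xi>\<^sub>i\<close>.\<close>

definition simple_process ::
  "'a measure \<Rightarrow> ereal \<Rightarrow> (real \<Rightarrow> 'a measure) \<Rightarrow> nat \<Rightarrow> (nat \<Rightarrow> real) \<Rightarrow> (nat \<Rightarrow> 'a \<Rightarrow> real) \<Rightarrow> bool" where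
  "simple_process M T F k \<tau> \<xi> \<longleftrightarrow>
     (\<forall>i\<le>k. \<tau> i \<in> time_set T) \<and>
     (\<forall>i<k. \<tau> i < \<tau> (Suc i) \<and> \<xi> i \<in> borel_measurable (F (\<tau> i)) \<and>
        (\<exists>C. \<forall>\<omega>\<in>space M. \<bar>\<xi> i \<omega>\<bar> \<le> C))"

definition simple_value ::
  "nat \<Rightarrow> (nat \<Rightarrow> real) \<Rightarrow> (nat \<Rightarrow> 'a \<Rightarrow> real) \<Rightarrow> real \<Rightarrow> 'a \<Rightarrow> real" where
  "simple_value k \<tau> \<xi> s \<omega> = (\<Sum>i<k. \<xi> i \<omega> * indicator {\<tau> i<..\<tau> (Suc i)} s)"

definition simple_integral ::
  "(real \<Rightarrow> 'a \<Rightarrow> real) \<Rightarrow> nat \<Rightarrow> (nat \<Rightarrow> real) \<Rightarrow> (nat \<Rightarrow> 'a \<Rightarrow> real) \<Rightarrow> real \<Rightarrow> 'a \<Rightarrow> real" where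
  "simple_integral B k \<tau> \<xi> t \<omega> =
     (\<Sum>i<k. \<xi> i \<omega> * (B (min (\<tau> (Suc i)) t) \<omega> - B (min (\<tau> i) t) \<omega>))"

text \<open>\<open>ito_integral M T F B H I\<close>: the process \<open>I\<close> is a continuous version of the Ito integral
  \<open>\<integral>\<^sub>0\<^sup>t H\<^sub>s dB\<^sub>s\<close> of a progressively measurable \<open>H\<close> with \<open>\<integral>\<^sub>0\<^sup>t H\<^sub>s\<^sup>2 ds < \<infinity>\<close> almost surely, i.e. the
  limit in probability of the integrals of simple processes that converge to \<open>H\<close> in
  \<open>L\<^sup>2([0,t])\<close> in probability. The limit does not depend on the approximating sequence, so such
  an \<open>I\<close> is unique up to indistinguishability.\<close>

definition ito_integral ::
  "'a measure \<Rightarrow> ereal \<Rightarrow> (real \<Rightarrow> 'a measure) \<Rightarrow> (real \<Rightarrow> 'a \<Rightarrow> real) \<Rightarrow>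
   (real \<Rightarrow> 'a \<Rightarrow> real) \<Rightarrow> (real \<Rightarrow> 'a \<Rightarrow> real) \<Rightarrow> bool" where
  "ito_integral M T F B H I \<longleftrightarrow>
     progressive T F H \<and>
     (\<forall>t\<in>time_set T. AE \<omega> in M. set_integrable lborel {0..t} (\<lambda>s. (H s \<omega>)\<^sup>2)) \<and>
     adapted T F I \<and> continuous_process M T I \<and>
     (\<exists>k \<tau> \<xi>.
        (\<forall>n. simple_process M T F (k n) (\<tau> n) (\<xi> n)) \<and>
        (\<forall>t\<in>time_set T.
           tendsto_in_prob M
             (\<lambda>n \<omega>. LINT s:{0..t}|lborel. (simple_value (k n) (\<tau> n) (\<xi> n) s \<omega> - H s \<omega>)\<^sup>2) (\<lambda>\<omega>. 0) \<and>
           tendsto_in_prob M (\<lambda>n. simple_integral B (k n) (\<tau> n) (\<xi> n) t) (I t)))"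

text \<open>\<open>X\<close> is an Ito process with stochastic differential \<open>dX\<^sub>t = \<mu>\<^sub>t dt + \<nu>\<^sub>t dB\<^sub>t\<close>.\<close>

definition ito_process ::
  "'a measure \<Rightarrow> ereal \<Rightarrow> (real \<Rightarrow> 'a measure) \<Rightarrow> (real \<Rightarrow> 'a \<Rightarrow> real) \<Rightarrow>
   (real \<Rightarrow> 'a \<Rightarrow> real) \<Rightarrow> (real \<Rightarrow> 'a \<Rightarrow> real) \<Rightarrow> (real \<Rightarrow> 'a \<Rightarrow> real) \<Rightarrow> bool" where
  "ito_process M T F B \<mu> \<nu> X \<longleftrightarrow>
     adapted T F X \<and> continuous_process M T X \<and>
     progressive T F \<mu> \<and>
     (\<forall>t\<in>time_set T. AE \<omega> in M. set_integrable lborel {0..t} (\<lambda>s. \<mu> s \<omega>)) \<and>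
     (\<exists>I. ito_integral M T F B \<nu> I \<and>
        (AE \<omega> in M. \<forall>t\<in>time_set T. X t \<omega> = X 0 \<omega> + (LINT s:{0..t}|lborel. \<mu> s \<omega>) + I t \<omega>))"

text \<open>\<open>J\<close> is a version of \<open>\<integral>\<^sub>0\<^sup>t Y\<^sub>s dX\<^sub>s = \<integral>\<^sub>0\<^sup>t Y\<^sub>s \<mu>\<^sub>s ds + \<integral>\<^sub>0\<^sup>t Y\<^sub>s \<nu>\<^sub>s dB\<^sub>s\<close>, where
  \<open>dX\<^sub>t = \<mu>\<^sub>t dt + \<nu>\<^sub>t dB\<^sub>t\<close>. The decomposition of \<open>X\<close> is unique up to null sets, so the integral
  depends on \<open>X\<close> and \<open>Y\<close> only.\<close>

definition ito_process_integral ::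
  "'a measure \<Rightarrow> ereal \<Rightarrow> (real \<Rightarrow> 'a measure) \<Rightarrow> (real \<Rightarrow> 'a \<Rightarrow> real) \<Rightarrow>
   (real \<Rightarrow> 'a \<Rightarrow> real) \<Rightarrow> (real \<Rightarrow> 'a \<Rightarrow> real) \<Rightarrow> (real \<Rightarrow> 'a \<Rightarrow> real) \<Rightarrow>
   (real \<Rightarrow> 'a \<Rightarrow> real) \<Rightarrow> (real \<Rightarrow> 'a \<Rightarrow> real) \<Rightarrow> bool" where
  "ito_process_integral M T F B \<mu> \<nu> X Y J \<longleftrightarrow>
     ito_process M T F B \<mu> \<nu> X \<and>
     ito_process M T F B (\<lambda>s \<omega>. Y s \<omega> * \<mu> s \<omega>) (\<lambda>s \<omega>. Y s \<omega> * \<nu> s \<omega>) J \<and>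
     (AE \<omega> in M. J 0 \<omega> = 0)"

text \<open>Solutions of \<open>dX\<^sub>t = m(t, X\<^sub>t) dt + v(t, X\<^sub>t) dB\<^sub>t\<close>, \<open>X\<^sub>0 = x0\<close>, on the given stochastic basis.
  A solution is strong because it is adapted to \<open>F\<close>, if \<open>F\<close> is the augmented natural
  filtration of \<open>B\<close>.\<close>

definition strong_solution ::
  "'a measure \<Rightarrow> ereal \<Rightarrow> (real \<Rightarrow> 'a measure) \<Rightarrow> (real \<Rightarrow> 'a \<Rightarrow> real) \<Rightarrow>
   (real \<Rightarrow> real \<Rightarrow> real) \<Rightarrow> (real \<Rightarrow> real \<Rightarrow> real) \<Rightarrow> real \<Rightarrow> (real \<Rightarrow> 'a \<Rightarrow> real) \<Rightarrow> bool" where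
  "strong_solution M T F B m v x0 X \<longleftrightarrow>
     ito_process M T F B (\<lambda>t \<omega>. m t (X t \<omega>)) (\<lambda>t \<omega>. v t (X t \<omega>)) X \<and>
     (AE \<omega> in M. X 0 \<omega> = x0)"

definition information ::
  "(real \<Rightarrow> real) \<Rightarrow> (real \<Rightarrow> real) \<Rightarrow> (real \<Rightarrow> 'a \<Rightarrow> real) \<Rightarrow> real \<Rightarrow> 'a \<Rightarrow> real" where
  "information b \<sigma> X t \<omega> = (LINT s:{0..t}|lborel. (b s)\<^sup>2 * (X s \<omega>)\<^sup>2 / (\<sigma> s)\<^sup>2)"

text \<open>In the next two definitions \<open>J\<close> stands for a version of \<open>\<integral>\<^sub>0\<^sup>t b(s) X\<^sub>s / \<sigma>(s)\<^sup>2 dX\<^sub>s\<close>.\<close>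

definition log_likelihood ::
  "(real \<Rightarrow> real) \<Rightarrow> (real \<Rightarrow> real) \<Rightarrow> (real \<Rightarrow> 'a \<Rightarrow> real) \<Rightarrow> (real \<Rightarrow> 'a \<Rightarrow> real) \<Rightarrow>
   real \<Rightarrow> 'a \<Rightarrow> real \<Rightarrow> real" where
  "log_likelihood b \<sigma> X J t \<omega> \<theta> = \<theta> * J t \<omega> - \<theta>\<^sup>2 / 2 * information b \<sigma> X t \<omega>"

text \<open>The maximizer exists and is unique whenever the information is positive; otherwise the
  value is unspecified.\<close>

definition mle ::
  "(real \<Rightarrow> real) \<Rightarrow> (real \<Rightarrow> real) \<Rightarrow> (real \<Rightarrow> 'a \<Rightarrow> real) \<Rightarrow> (real \<Rightarrow> 'a \<Rightarrow> real) \<Rightarrow>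
   real \<Rightarrow> 'a \<Rightarrow> real" where
  "mle b \<sigma> X J t \<omega> = arg_max (log_likelihood b \<sigma> X J t \<omega>) (\<lambda>\<theta>. True)"

end

theory Submission
  imports Defs
begin

text \<open>The log-likelihood is a quadratic polynomial in \<open>\<theta>\<close>, so where the information \<open>A\<^sub>t\<close> is positive
  the estimator equals \<open>J\<^sub>t / A\<^sub>t = \<alpha> + I\<^sub>t / A\<^sub>t\<close>. Here \<open>I\<close> is the Ito integral of \<open>H = b X / \<sigma>\<close>,
  and \<open>A\<^sub>t = \<integral>\<^sub>0\<^sup>t H\<^sub>s\<^sup>2 ds\<close> is its quadratic variation. Consistency is therefore the strong law of large numbers
  \<open>I\<^sub>t / A\<^sub>t \<longlongrightarrow> 0\<close> where \<open>A\<^sub>t\<close> tends to infinity (\<open>ito_integral_strong_law\<close>).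

  The usual proofs of this law represent \<open>I\<close> as a time-changed Wiener process or apply a martingale
  convergence theorem to \<open>\<integral> (1 + A)\<^sup>-\<^sup>1 dI\<close>. The argument here is more elementary. For a simple integrand
  and a real number \<open>a\<close>, \<open>exp (a I\<^sub>t - a\<^sup>2 A\<^sub>t / 2)\<close> is a positive martingale with
  expectation 1, because the increments of \<open>B\<close> are Gaussian and independent of the past
  (\<open>exp_increment_expectation\<close>). Doob's maximal inequality bounds the probability that
  \<open>a I - a\<^sup>2 A / 2\<close> ever reaches a level \<open>c\<close> by \<open>exp (- c)\<close>
  (\<open>simple_integral_maximal_inequality\<close>). This bound depends neither on the integrand nor on the times
  of observation, so, with slightly worse constants, it survives the limit in probability that
  defines the Ito integral (\<open>ito_integral_maximal_inequality\<close>). Hence, almost surely,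
  \<open>a I\<^sub>t \<le> c + a\<^sup>2 A\<^sub>t\<close> for all \<open>t\<close>, with a random constant \<open>c\<close> (\<open>ito_integral_AE_bound\<close>).
  Dividing by \<open>a A\<^sub>t\<close> for small \<open>a\<close> of both signs gives the strong law.\<close>

section \<open>The exponential martingale of a Wiener process\<close>

text \<open>Completing the square: an exponential tilt of a centred Gaussian density is a shifted Gaussian
  density. The normalisation \<open>a\<^sup>2 s\<^sup>2 / 2\<close> is what makes the exponential functional of a Wiener
  process a martingale.\<close>

lemma normal_density_exp_tilt:
  assumes "0 < s"
  shows "normal_density 0 s y * exp (a * y - a\<^sup>2 * s\<^sup>2 / 2) = normal_density (a * s\<^sup>2) s y"
proof -
  have "- (y - 0)\<^sup>2 / (2 * s\<^sup>2) + (a * y - a\<^sup>2 * s\<^sup>2 / 2) = - (y - a * s\<^sup>2)\<^sup>2 / (2 * s\<^sup>2)"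
    using assms by (simp add: field_simps power2_eq_square)
  then show ?thesis
    by (simp add: normal_density_def flip: exp_add)
qed

lemma nn_integral_normal_density_exp:
  assumes "0 < s"
  shows "(\<integral>\<^sup>+ y. ennreal (normal_density 0 s y) * ennreal (exp (a * y - a\<^sup>2 * s\<^sup>2 / 2)) \<partial>lborel) = 1"
proof -
  interpret N: prob_space "density lborel (normal_density (a * s\<^sup>2) s)"
    using assms by (rule prob_space_normal_density)
  have "(\<integral>\<^sup>+ y. ennreal (normal_density 0 s y) * ennreal (exp (a * y - a\<^sup>2 * s\<^sup>2 / 2)) \<partial>lborel)
      = (\<integral>\<^sup>+ y. ennreal (normal_density (a * s\<^sup>2) s y) \<partial>lborel)"
    using assms by (simp add: normal_density_exp_tilt normal_density_nonneg flip: ennreal_mult)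
  also have "\<dots> = 1"
    using N.emeasure_space_1 by (simp add: emeasure_density)
  finally show ?thesis .
qed

locale wiener_basis = prob_space M for M :: "'a measure" +
  fixes T :: ereal and F :: "real \<Rightarrow> 'a measure" and B :: "real \<Rightarrow> 'a \<Rightarrow> real"
  assumes filtration: "filtration_on M T F"
    and wiener: "wiener_process M T F B"
begin

lemma subalgebra_F: "t \<in> time_set T \<Longrightarrow> subalgebra M (F t)"
  using filtration by (auto simp: filtration_on_def)

lemma space_F: "t \<in> time_set T \<Longrightarrow> space (F t) = space M"
  using subalgebra_F by (auto simp: subalgebra_def)

lemma measurable_F_M: "t \<in> time_set T \<Longrightarrow> f \<in> measurable (F t) N \<Longrightarrow> f \<in> measurable M N"
  using subalgebra_F measurable_from_subalg by blast

lemma measurable_F_mono: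
  assumes "s \<in> time_set T" "t \<in> time_set T" "s \<le> t" "f \<in> measurable (F s) N"
  shows "f \<in> measurable (F t) N"
proof -
  have "subalgebra (F t) (F s)"
    using assms filtration by (auto simp: subalgebra_def filtration_on_def)
  then show ?thesis
    using assms(4) measurable_from_subalg by blast
qed

lemma wiener_measurable:
  assumes "s \<in> time_set T" "t \<in> time_set T" "s \<le> t"
  shows "B s \<in> borel_measurable (F t)"
  using assms wiener
  by (intro measurable_F_mono[of s t]) (auto simp: wiener_process_def adapted_def)

text \<open>One step of the exponential martingale: as \<open>B\<^sub>t - B\<^sub>s\<close> is independent of \<open>F\<^sub>s\<close>, the variables
  \<open>\<eta>\<close> and \<open>G\<close> may be frozen and the increment integrated out first, which gives the factor 1.
  Integrating against all nonnegative weights \<open>G\<close> expresses that the exponential factor has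
  conditional expectation 1 given \<open>F\<^sub>s\<close>.\<close>

lemma exp_increment_expectation:
  assumes s: "s \<in> time_set T" and t: "t \<in> time_set T" and st: "s < t"
    and \<eta>[measurable]: "\<eta> \<in> borel_measurable (F s)"
    and G[measurable]: "G \<in> borel_measurable (F s)"
  shows "(\<integral>\<^sup>+ \<omega>. G \<omega> * ennreal (exp (\<eta> \<omega> * (B t \<omega> - B s \<omega>) - (\<eta> \<omega>)\<^sup>2 * (t - s) / 2)) \<partial>M)
    = (\<integral>\<^sup>+ \<omega>. G \<omega> \<partial>M)"
proof -
  define D where "D = (\<lambda>\<omega>. B t \<omega> - B s \<omega>)"
  define g where "g = (\<lambda>(\<omega>, y). G \<omega> * ennreal (exp (\<eta> \<omega> * y - (\<eta> \<omega>)\<^sup>2 * (t - s) / 2)))"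
  have dist: "distributed M lborel D (\<lambda>x. ennreal (normal_density 0 (sqrt (t - s)) x))"
    and ind: "indep_set (sets (F s)) {D -` A \<inter> space M | A. A \<in> sets borel}"
    using wiener s t st by (auto simp: wiener_process_def D_def)
  have D[measurable]: "D \<in> borel_measurable M"
    using distributed_measurable[OF dist] by simp
  have idm: "(\<lambda>\<omega>. \<omega>) \<in> measurable M (F s)"
    using subalgebra_F[OF s] by (auto intro: measurable_from_subalg)
  interpret D: prob_space "distr M borel D"
    by (rule prob_space_distr) simp
  interpret I: prob_space "distr M (F s) (\<lambda>\<omega>. \<omega>)"
    by (rule prob_space_distr) (rule idm)
  have pair: "(\<lambda>\<omega>. (\<omega>, D \<omega>)) \<in> measurable M (F s \<Otimes>\<^sub>M borel)"
    by (intro measurable_Pair idm D)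
  \<comment> \<open>Independence of a \<open>\<sigma>\<close>-algebra and a random variable as a product law; the first factor is the
      identity map into \<open>F\<^sub>s\<close>.\<close>
  have joint: "distr M (F s) (\<lambda>\<omega>. \<omega>) \<Otimes>\<^sub>M distr M borel D
      = distr M (F s \<Otimes>\<^sub>M borel) (\<lambda>\<omega>. (\<omega>, D \<omega>))"
  proof (rule pair_measure_eqI)
    fix A C
    assume "A \<in> sets (distr M (F s) (\<lambda>\<omega>. \<omega>))" "C \<in> sets (distr M borel D)"
    then have A: "A \<in> sets (F s)" and C: "C \<in> sets borel"
      by simp_all
    have "A \<subseteq> space M"
      using sets.sets_into_space[OF A] space_F[OF s] by simp
    then have *: "(\<lambda>\<omega>. \<omega>) -` A \<inter> space M = A"
      "(\<lambda>\<omega>. (\<omega>, D \<omega>)) -` (A \<times> C) \<inter> space M = A \<inter> (D -` C \<inter> space M)"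
      by auto
    have "prob (A \<inter> (D -` C \<inter> space M)) = prob A * prob (D -` C \<inter> space M)"
      using A C by (intro indep_setD[OF ind]) auto
    then show "emeasure (distr M (F s) (\<lambda>\<omega>. \<omega>)) A * emeasure (distr M borel D) C
      = emeasure (distr M (F s \<Otimes>\<^sub>M borel) (\<lambda>\<omega>. (\<omega>, D \<omega>))) (A \<times> C)"
      using A C by (simp add: emeasure_distr idm pair * Int_absorb2[OF \<open>A \<subseteq> space M\<close>] emeasure_eq_measure ennreal_mult)
  qed (simp_all add: I.sigma_finite_measure_axioms D.sigma_finite_measure_axioms)
  have g[measurable]: "g \<in> borel_measurable (F s \<Otimes>\<^sub>M borel)"
    unfolding g_def by measurable
  have inner: "(\<integral>\<^sup>+ y. g (\<omega>, y) \<partial>distr M borel D) = G \<omega>" if "\<omega> \<in> space M" for \<omega>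
  proof -
    have "(\<integral>\<^sup>+ y. g (\<omega>, y) \<partial>distr M borel D)
        = G \<omega> * (\<integral>\<^sup>+ y. ennreal (exp (\<eta> \<omega> * y - (\<eta> \<omega>)\<^sup>2 * (t - s) / 2)) \<partial>distr M borel D)"
      by (simp add: g_def nn_integral_cmult)
    also have "(\<integral>\<^sup>+ y. ennreal (exp (\<eta> \<omega> * y - (\<eta> \<omega>)\<^sup>2 * (t - s) / 2)) \<partial>distr M borel D)
       = (\<integral>\<^sup>+ x. ennreal (exp (\<eta> \<omega> * D x - (\<eta> \<omega>)\<^sup>2 * (t - s) / 2)) \<partial>M)"
      by (simp add: nn_integral_distr)
    also have "\<dots> = (\<integral>\<^sup>+ y. ennreal (normal_density 0 (sqrt (t - s)) y)
        * ennreal (exp (\<eta> \<omega> * y - (\<eta> \<omega>)\<^sup>2 * (t - s) / 2)) \<partial>lborel)"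
      by (subst distributed_nn_integral[OF dist]) simp_all
    also have "\<dots> = 1"
      using nn_integral_normal_density_exp[of "sqrt (t - s)" "\<eta> \<omega>"] st by simp
    finally show ?thesis by simp
  qed
  have "(\<integral>\<^sup>+ \<omega>. G \<omega> * ennreal (exp (\<eta> \<omega> * (B t \<omega> - B s \<omega>) - (\<eta> \<omega>)\<^sup>2 * (t - s) / 2)) \<partial>M)
      = (\<integral>\<^sup>+ \<omega>. g (\<omega>, D \<omega>) \<partial>M)"
    by (simp add: g_def D_def)
  also have "\<dots> = (\<integral>\<^sup>+ z. g z \<partial>distr M (F s \<Otimes>\<^sub>M borel) (\<lambda>\<omega>. (\<omega>, D \<omega>)))"
    using g by (intro nn_integral_distr[symmetric] pair) (simp only: measurable_distr_eq1)
  also have "\<dots> = (\<integral>\<^sup>+ z. g z \<partial>(distr M (F s) (\<lambda>\<omega>. \<omega>) \<Otimes>\<^sub>M distr M borel D))"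
    by (simp add: joint)
  also have "\<dots> = (\<integral>\<^sup>+ \<omega>. \<integral>\<^sup>+ y. g (\<omega>, y) \<partial>distr M borel D \<partial>distr M (F s) (\<lambda>\<omega>. \<omega>))"
    by (rule D.nn_integral_fst[symmetric]) simp
  also have "\<dots> = (\<integral>\<^sup>+ \<omega>. \<integral>\<^sup>+ y. g (\<omega>, y) \<partial>distr M borel D \<partial>M)"
    by (rule nn_integral_distr[OF idm]) (measurable)
  also have "\<dots> = (\<integral>\<^sup>+ \<omega>. G \<omega> \<partial>M)"
    by (rule nn_integral_cong) (rule inner)
  finally show ?thesis .
qed

text \<open>Doob's maximal inequality for the martingale \<open>exp L\<^sub>j\<close>. The process \<open>V\<^sub>j\<close> of the proof is
  \<open>exp L\<^sub>j\<close> until \<open>L\<close> first reaches level \<open>c\<close>, and is frozen at \<open>exp c\<close> from then on. Lowering the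
  overshoot to \<open>exp c\<close> can only decrease the expectation, so \<open>V\<close> is a supermartingale with
  \<open>V\<^sub>0 \<le> 1\<close>, and Markov's inequality at the final time bounds the probability of ever reaching \<open>c\<close>.\<close>

lemma grid_maximal_inequality:
  fixes r :: "nat \<Rightarrow> real" and \<eta> :: "nat \<Rightarrow> 'a \<Rightarrow> real"
  assumes r: "\<And>i. i \<le> m \<Longrightarrow> r i \<in> time_set T"
    and mono: "\<And>i. i < m \<Longrightarrow> r i < r (Suc i)"
    and \<eta>: "\<And>i. i < m \<Longrightarrow> \<eta> i \<in> borel_measurable (F (r i))"
  defines "L \<equiv> \<lambda>j \<omega>. \<Sum>i<j. \<eta> i \<omega> * (B (r (Suc i)) \<omega> - B (r i) \<omega>)
                            - (\<eta> i \<omega>)\<^sup>2 * (r (Suc i) - r i) / 2"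
  shows "{\<omega>\<in>space M. \<exists>j\<le>m. c \<le> L j \<omega>} \<in> events"
    and "prob {\<omega>\<in>space M. \<exists>j\<le>m. c \<le> L j \<omega>} \<le> exp (- c)"
proof -
  have le: "r i \<le> r j" if "i \<le> j" "j \<le> m" for i j
    using that
  proof (induction rule: dec_induct)
    case (step n)
    then show ?case using mono[of n] by simp
  qed simp
  have L_meas: "L l \<in> borel_measurable (F (r j))" if "l \<le> j" "j \<le> m" for l j
  proof -
    have "\<eta> i \<in> borel_measurable (F (r j))" "B (r i) \<in> borel_measurable (F (r j))"
      "B (r (Suc i)) \<in> borel_measurable (F (r j))" if "i < l" for i
      using that \<open>l \<le> j\<close> \<open>j \<le> m\<close>
      by (auto intro!: measurable_F_mono[OF r r le \<eta>] wiener_measurable r le)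
    then show ?thesis
      unfolding L_def by (intro borel_measurable_sum borel_measurable_diff borel_measurable_times
        borel_measurable_divide borel_measurable_power borel_measurable_const) auto
  qed
  define V where "V = (\<lambda>j \<omega>. if \<exists>l\<le>j. c \<le> L l \<omega> then ennreal (exp c) else ennreal (exp (L j \<omega>)))"
  have V: "(\<integral>\<^sup>+ \<omega>. V j \<omega> \<partial>M) \<le> 1" if "j \<le> m" for j
    using that
  proof (induction j)
    case 0
    have "V 0 \<omega> \<le> 1" for \<omega>
      by (auto simp: V_def L_def)
    then have "(\<integral>\<^sup>+ \<omega>. V 0 \<omega> \<partial>M) \<le> (\<integral>\<^sup>+ \<omega>. 1 \<partial>M)"
      by (intro nn_integral_mono) auto
    then show ?case by (simp add: emeasure_space_1)
  next
    case (Suc j)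
    define P where "P = (\<lambda>\<omega>. \<exists>l\<le>j. c \<le> L l \<omega>)"
    define I where "I = (\<lambda>\<omega>. \<eta> j \<omega> * (B (r (Suc j)) \<omega> - B (r j) \<omega>)
      - (\<eta> j \<omega>)\<^sup>2 * (r (Suc j) - r j) / 2)"
    \<comment> \<open>\<open>G1 + G2\<close> is \<open>V\<^sub>j\<close>, split into its frozen and its running part; only the latter gets a
        new factor.\<close>
    define G1 where "G1 = (\<lambda>\<omega>. if P \<omega> then ennreal (exp c) else 0)"
    define G2 where "G2 = (\<lambda>\<omega>. if P \<omega> then 0 else ennreal (exp (L j \<omega>)))"
    have rj: "r j \<in> time_set T" "r (Suc j) \<in> time_set T" "r j < r (Suc j)"
      using Suc.prems by (auto intro: r mono)
    have [measurable]: "L l \<in> borel_measurable (F (r j))" if "l \<le> j" for l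
      using that Suc.prems by (auto intro: L_meas)
    have [measurable]: "Measurable.pred (F (r j)) P"
    proof -
      have "Measurable.pred (F (r j)) (\<lambda>\<omega>. \<exists>l\<in>{..j}. c \<le> L l \<omega>)"
        by (rule pred_intros_finite(4)) (simp_all add: L_meas Suc_leD[OF Suc.prems])
      then show ?thesis
        by (simp add: P_def Bex_def)
    qed
    have G[measurable]: "G1 \<in> borel_measurable (F (r j))" "G2 \<in> borel_measurable (F (r j))"
      unfolding G1_def G2_def by measurable
    have GM[measurable]: "G1 \<in> borel_measurable M" "G2 \<in> borel_measurable M"
      by (rule measurable_F_M[OF rj(1) G(1)], rule measurable_F_M[OF rj(1) G(2)])
    have [measurable]: "\<eta> j \<in> borel_measurable M" "B (r j) \<in> borel_measurable M"
        "B (r (Suc j)) \<in> borel_measurable M"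
      using Suc.prems
      by (auto intro: measurable_F_M[OF rj(1) \<eta>] measurable_F_M[OF rj(1)] measurable_F_M[OF rj(2)]
        wiener_measurable[OF rj(1) rj(1)] wiener_measurable[OF rj(2) rj(2)])
    have [measurable]: "I \<in> borel_measurable M"
      unfolding I_def by measurable
    have "L (Suc j) \<omega> = L j \<omega> + I \<omega>" for \<omega>
      by (simp add: L_def I_def)
    moreover have "ennreal (exp x) * ennreal (exp y) = ennreal (exp (x + y))" for x y :: real
      by (simp add: exp_add ennreal_mult)
    ultimately have "V (Suc j) \<omega> \<le> G1 \<omega> + G2 \<omega> * ennreal (exp (I \<omega>))" for \<omega>
      by (auto simp: V_def G1_def G2_def P_def le_Suc_eq)
    then have "(\<integral>\<^sup>+ \<omega>. V (Suc j) \<omega> \<partial>M) \<le> (\<integral>\<^sup>+ \<omega>. G1 \<omega> + G2 \<omega> * ennreal (exp (I \<omega>)) \<partial>M)"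
      by (intro nn_integral_mono)
    also have "\<dots> = (\<integral>\<^sup>+ \<omega>. G1 \<omega> \<partial>M) + (\<integral>\<^sup>+ \<omega>. G2 \<omega> * ennreal (exp (I \<omega>)) \<partial>M)"
      by (rule nn_integral_add) auto
    also have "(\<integral>\<^sup>+ \<omega>. G2 \<omega> * ennreal (exp (I \<omega>)) \<partial>M) = (\<integral>\<^sup>+ \<omega>. G2 \<omega> \<partial>M)"
      unfolding I_def using Suc.prems by (intro exp_increment_expectation rj \<eta> G) auto
    also have "(\<integral>\<^sup>+ \<omega>. G1 \<omega> \<partial>M) + \<dots> = (\<integral>\<^sup>+ \<omega>. G1 \<omega> + G2 \<omega> \<partial>M)"
      by (rule nn_integral_add[symmetric]) auto
    also have "(\<lambda>\<omega>. G1 \<omega> + G2 \<omega>) = V j"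
      by (rule ext) (auto simp: V_def G1_def G2_def P_def)
    also have "integral\<^sup>N M (V j) \<le> 1"
      using Suc by simp
    finally show ?case .
  qed
  have [measurable]: "L l \<in> borel_measurable M" if "l \<le> m" for l
    using measurable_F_M[OF r L_meas] that by auto
  show E: "{\<omega>\<in>space M. \<exists>j\<le>m. c \<le> L j \<omega>} \<in> events" (is "?E \<in> _")
  proof -
    have "Measurable.pred M (\<lambda>\<omega>. \<exists>l\<in>{..m}. c \<le> L l \<omega>)"
      by (rule pred_intros_finite(4)) simp_all
    then show ?thesis
      by (simp add: pred_def Bex_def)
  qed
  have "ennreal (exp c) * emeasure M ?E = (\<integral>\<^sup>+ \<omega>. ennreal (exp c) * indicator ?E \<omega> \<partial>M)"
    using E by (simp add: nn_integral_cmult_indicator)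
  also have "\<dots> \<le> (\<integral>\<^sup>+ \<omega>. V m \<omega> \<partial>M)"
    by (intro nn_integral_mono) (auto simp: V_def split: split_indicator)
  also have "\<dots> \<le> 1"
    by (rule V) simp
  finally have "ennreal (exp c * prob ?E) \<le> 1"
    by (simp add: emeasure_eq_measure ennreal_mult)
  then have "exp c * prob ?E \<le> 1"
    by (simp add: ennreal_le_1)
  then show "prob ?E \<le> exp (- c)"
    by (simp add: exp_minus field_simps)
qed

end

section \<open>Simple integrals on a grid\<close>

lemma time_set_downward: "t \<in> time_set T \<Longrightarrow> 0 \<le> s \<Longrightarrow> s \<le> t \<Longrightarrow> s \<in> time_set T"
  using le_less_trans[of "ereal s" "ereal t" T] by (simp add: time_set_def)

text \<open>Supplies a common grid for the partition of a simple process, the times of observation and 0.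
  Starting the grid at 0 identifies the discrete sums with integrals over \<open>[0,t]\<close>.\<close>

lemma ex_increasing_enumeration:
  fixes G :: "real set"
  assumes "finite G" "0 \<in> G" "\<And>x. x \<in> G \<Longrightarrow> 0 \<le> x"
  obtains r :: "nat \<Rightarrow> real" and m where "r ` {..m} = G" "r 0 = 0" "strict_mono_on {..m} r"
proof -
  define xs where "xs = sorted_list_of_set G"
  define m where "m = length xs - 1"
  have xs: "set xs = G" "sorted_wrt (<) xs"
    using assms(1) by (auto simp: xs_def)
  then have ne: "length xs > 0"
    using assms(2) by auto
  then have m: "i \<le> m \<longleftrightarrow> i < length xs" for i
    unfolding m_def by linarith
  have img: "(!) xs ` {..m} = G"
    unfolding xs(1)[symmetric] set_conv_nth by (simp add: m image_def Bex_def) blast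
  have mono: "xs ! i < xs ! j" if "i < j" "j \<le> m" for i j
    by (rule sorted_wrt_nth_less[OF xs(2) that(1)]) (use that(2) m in blast)
  then have smono: "strict_mono_on {..m} ((!) xs)"
    by (simp add: strict_mono_on_def)
  have "0 \<in> (!) xs ` {..m}"
    unfolding img by (rule assms(2))
  then obtain j where j: "j \<le> m" "xs ! j = 0"
    by (metis atMost_iff imageE)
  have "xs ! 0 \<le> xs ! j"
    using mono[of 0 j] j by (cases "j = 0") simp_all
  moreover have "0 \<le> xs ! 0"
    by (rule assms(3)) (simp flip: img)
  ultimately have 0: "xs ! 0 = 0"
    using j by simp
  show ?thesis
    by (rule that[OF img 0 smono])
qed

locale time_grid =
  fixes r :: "nat \<Rightarrow> real" and m :: nat
  assumes grid_strict_mono: "strict_mono_on {..m} r"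
begin

lemma grid_less: "i < j \<Longrightarrow> j \<le> m \<Longrightarrow> r i < r j"
  using grid_strict_mono by (simp add: strict_mono_on_def)

lemma grid_le: "i \<le> j \<Longrightarrow> j \<le> m \<Longrightarrow> r i \<le> r j"
  using grid_less[of i j] by (cases "i = j") auto

lemma grid_point_cases:
  assumes "u \<in> r ` {..m}" "l < m"
  shows "u \<le> r l \<or> r (Suc l) \<le> u"
proof -
  obtain i where "i \<le> m" "u = r i"
    using assms by auto
  then show ?thesis
    using grid_le[of i l] grid_le[of "Suc l" i] assms by (cases "i \<le> l") auto
qed

text \<open>The increment of the stopped path \<open>f (min u t)\<close> over a cell is either the full increment of \<open>f\<close>
  or 0, because the grid point \<open>u\<close> is never interior to a cell.\<close>

lemma stopped_increment_telescope:
  fixes f :: "real \<Rightarrow> real"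
  assumes u: "u \<in> r ` {..m}" and "j \<le> m"
  shows "f (min u (r j)) - f (r 0) = (\<Sum>l<j. of_bool (r (Suc l) \<le> u) * (f (r (Suc l)) - f (r l)))"
  using \<open>j \<le> m\<close>
proof (induction j)
  case 0
  then have "r 0 \<le> u"
    using u grid_le by auto
  then show ?case by (simp add: min_absorb2)
next
  case (Suc j)
  then have "r j < r (Suc j)"
    by (intro grid_less) auto
  then show ?case
    using Suc grid_point_cases[OF u, of j]
    by (auto simp: min_def)
qed

lemma stopped_increment_grid:
  fixes f :: "real \<Rightarrow> real"
  assumes u: "u \<in> r ` {..m}" and v: "v \<in> r ` {..m}" and "u < v" "j \<le> m"
  shows "f (min v (r j)) - f (min u (r j))
    = (\<Sum>l<j. indicator {u<..v} (r (Suc l)) * (f (r (Suc l)) - f (r l)))"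
proof -
  have "f (min v (r j)) - f (min u (r j))
    = (f (min v (r j)) - f (r 0)) - (f (min u (r j)) - f (r 0))"
    by simp
  also have "\<dots> = (\<Sum>l<j. of_bool (r (Suc l) \<le> v) * (f (r (Suc l)) - f (r l))
      - of_bool (r (Suc l) \<le> u) * (f (r (Suc l)) - f (r l)))"
    unfolding stopped_increment_telescope[OF u \<open>j \<le> m\<close>]
      stopped_increment_telescope[OF v \<open>j \<le> m\<close>] sum_subtractf ..
  also have "\<dots> = (\<Sum>l<j. indicator {u<..v} (r (Suc l)) * (f (r (Suc l)) - f (r l)))"
    using \<open>u < v\<close> by (intro sum.cong) (auto simp: indicator_def)
  finally show ?thesis .
qed

text \<open>On the grid a simple integral is a martingale transform. The height on the cell from \<open>r l\<close> to
  \<open>r (Suc l)\<close> is read off at the right endpoint since the intervals of a simple process are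
  closed on the right.\<close>

lemma simple_integral_grid:
  assumes "\<And>i. i \<le> k \<Longrightarrow> \<tau> i \<in> r ` {..m}" "\<And>i. i < k \<Longrightarrow> \<tau> i < \<tau> (Suc i)" "j \<le> m"
  shows "simple_integral B k \<tau> \<xi> (r j) \<omega>
    = (\<Sum>l<j. simple_value k \<tau> \<xi> (r (Suc l)) \<omega> * (B (r (Suc l)) \<omega> - B (r l) \<omega>))"
proof -
  have "simple_integral B k \<tau> \<xi> (r j) \<omega> = (\<Sum>i<k. \<xi> i \<omega> *
      (\<Sum>l<j. indicator {\<tau> i<..\<tau> (Suc i)} (r (Suc l)) * (B (r (Suc l)) \<omega> - B (r l) \<omega>)))"
    unfolding simple_integral_def
    using assms by (intro sum.cong) (auto simp: stopped_increment_grid[of _ _ j "\<lambda>t. B t \<omega>"])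
  also have "\<dots> = (\<Sum>l<j. \<Sum>i<k. \<xi> i \<omega> *
      (indicator {\<tau> i<..\<tau> (Suc i)} (r (Suc l)) * (B (r (Suc l)) \<omega> - B (r l) \<omega>)))"
    unfolding sum_distrib_left by (rule sum.swap)
  also have "\<dots> = (\<Sum>l<j. simple_value k \<tau> \<xi> (r (Suc l)) \<omega> * (B (r (Suc l)) \<omega> - B (r l) \<omega>))"
    unfolding simple_value_def sum_distrib_right by (simp only: mult.assoc)
  finally show ?thesis .
qed

lemma simple_value_on_cell:
  assumes \<tau>: "\<And>i. i \<le> k \<Longrightarrow> \<tau> i \<in> r ` {..m}" and l: "l < m" and s: "r l < s" "s \<le> r (Suc l)"
  shows "simple_value k \<tau> \<xi> s \<omega> = simple_value k \<tau> \<xi> (r (Suc l)) \<omega>"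
  unfolding simple_value_def
proof (intro sum.cong refl)
  fix i assume "i \<in> {..<k}"
  then show "\<xi> i \<omega> * indicator {\<tau> i<..\<tau> (Suc i)} s
      = \<xi> i \<omega> * indicator {\<tau> i<..\<tau> (Suc i)} (r (Suc l))"
    using grid_point_cases[OF \<tau> l, of i] grid_point_cases[OF \<tau> l, of "Suc i"] s
    by (auto simp: indicator_def)
qed

lemma simple_value_square_integral:
  assumes \<tau>: "\<And>i. i \<le> k \<Longrightarrow> \<tau> i \<in> r ` {..m}" and r0: "r 0 = 0" and "j \<le> m"
  shows "(LINT s:{0..r j}|lborel. (simple_value k \<tau> \<xi> s \<omega>)\<^sup>2)
    = (\<Sum>l<j. (simple_value k \<tau> \<xi> (r (Suc l)) \<omega>)\<^sup>2 * (r (Suc l) - r l))"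
proof -
  let ?f = "\<lambda>s. (simple_value k \<tau> \<xi> s \<omega>)\<^sup>2"
  have "has_bochner_integral lborel (\<lambda>s. indicator {0<..r j} s * ?f s)
      (\<Sum>l<j. ?f (r (Suc l)) * (r (Suc l) - r l))"
    using \<open>j \<le> m\<close>
  proof (induction j)
    case 0
    then show ?case by (simp add: r0) (rule has_bochner_integral_zero)
  next
    case (Suc j)
    have rj: "0 \<le> r j" "r j < r (Suc j)"
      using grid_le[of 0 j] grid_less[of j "Suc j"] Suc.prems r0 by auto
    have "has_bochner_integral lborel (\<lambda>s. indicator {r j<..r (Suc j)} s *\<^sub>R ?f (r (Suc j)))
        (measure lborel {r j<..r (Suc j)} *\<^sub>R ?f (r (Suc j)))"
      using rj by (intro has_bochner_integral_indicator) auto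
    moreover have "has_bochner_integral lborel (\<lambda>s. indicator {0<..r j} s * ?f s)
      (\<Sum>l<j. ?f (r (Suc l)) * (r (Suc l) - r l))"
      using Suc by simp
    ultimately have "has_bochner_integral lborel
      (\<lambda>s. indicator {0<..r j} s * ?f s + indicator {r j<..r (Suc j)} s *\<^sub>R ?f (r (Suc j)))
      (\<Sum>l<Suc j. ?f (r (Suc l)) * (r (Suc l) - r l))"
      using rj by (auto dest: has_bochner_integral_add simp: mult.commute)
    also have "(\<lambda>s. indicator {0<..r j} s * ?f s + indicator {r j<..r (Suc j)} s *\<^sub>R ?f (r (Suc j)))
      = (\<lambda>s. indicator {0<..r (Suc j)} s * ?f s)"
    proof (rule ext)
      fix s
      show "indicator {0<..r j} s * ?f s + indicator {r j<..r (Suc j)} s *\<^sub>R ?f (r (Suc j))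
        = indicator {0<..r (Suc j)} s * ?f s"
      proof (cases "r j < s \<and> s \<le> r (Suc j)")
        case True
        then have "simple_value k \<tau> \<xi> s \<omega> = simple_value k \<tau> \<xi> (r (Suc j)) \<omega>"
          using Suc.prems by (intro simple_value_on_cell \<tau>) auto
        then show ?thesis
          using True rj by (simp add: indicator_def)
      qed (use rj in \<open>auto simp: indicator_def\<close>)
    qed
    finally show ?case .
  qed
  moreover have "0 \<le> \<tau> i" if "i < k" for i
  proof -
    obtain l where "l \<le> m" "\<tau> i = r l"
      using \<tau>[of i] \<open>i < k\<close> by auto
    then show ?thesis
      using grid_le[of 0 l] r0 by simp
  qed
  \<comment> \<open>The intervals of the simple process are open on the left, so its value at 0 vanishes and
      \<open>{0<..t}\<close> may replace \<open>{0..t}\<close>.\<close>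
  then have "simple_value k \<tau> \<xi> 0 \<omega> = 0"
    unfolding simple_value_def by (intro sum.neutral) (auto simp: indicator_def not_less)
  then have "indicator {0<..r j} s * ?f s = indicator {0..r j} s * ?f s" for s
    by (cases "s = 0") (auto simp: indicator_def)
  ultimately show ?thesis
    by (simp add: set_lebesgue_integral_def has_bochner_integral_integral_eq)
qed

end

context wiener_basis
begin

text \<open>Refining the partition by the times in \<open>S\<close> reduces this to the maximal inequality on a grid. The
  bound is stated through a measurable superset \<open>E\<close>, the event on the whole grid, because this is
  all that the passage to the limit uses.\<close>

lemma simple_integral_maximal_inequality:
  assumes simple: "simple_process M T F k \<tau> \<xi>" and S: "finite S" "S \<subseteq> time_set T"
  obtains E where "E \<in> events" "prob E \<le> exp (- c)"
    "{\<omega>\<in>space M. \<exists>t\<in>S. c \<le> a * simple_integral B k \<tau> \<xi> t \<omega>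
        - a\<^sup>2 / 2 * (LINT s:{0..t}|lborel. (simple_value k \<tau> \<xi> s \<omega>)\<^sup>2)} \<subseteq> E"
proof -
  define G where "G = insert 0 (S \<union> \<tau> ` {..k})"
  have \<tau>: "\<And>i. i \<le> k \<Longrightarrow> \<tau> i \<in> time_set T" "\<And>i. i < k \<Longrightarrow> \<tau> i < \<tau> (Suc i)"
    and \<xi>: "\<And>i. i < k \<Longrightarrow> \<xi> i \<in> borel_measurable (F (\<tau> i))"
    using simple by (auto simp: simple_process_def)
  have "0 \<in> time_set T"
    by (rule time_set_downward[OF \<tau>(1)[OF le0]]) (use \<tau>(1)[of 0] in \<open>simp_all add: time_set_def\<close>)
  then have G: "finite G" "0 \<in> G" "G \<subseteq> time_set T"
    using S \<tau> by (auto simp: G_def)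
  then have nonneg: "\<And>x. x \<in> G \<Longrightarrow> 0 \<le> x"
    by (auto simp: time_set_def)
  obtain r :: "nat \<Rightarrow> real" and m where img: "r ` {..m} = G" and r0: "r 0 = 0"
    and "strict_mono_on {..m} r"
    by (rule ex_increasing_enumeration[OF G(1,2) nonneg])
  interpret time_grid r m
    by standard fact
  have \<tau>r: "\<And>i. i \<le> k \<Longrightarrow> \<tau> i \<in> r ` {..m}"
    by (auto simp: img G_def)
  have r: "r i \<in> time_set T" if "i \<le> m" for i
    using img G(3) that by auto
  define \<eta> where "\<eta> = (\<lambda>l \<omega>. a * simple_value k \<tau> \<xi> (r (Suc l)) \<omega>)"
  have \<eta>: "\<eta> l \<in> borel_measurable (F (r l))" if "l < m" for l
  proof -
    have "(\<lambda>\<omega>. \<xi> i \<omega> * indicator {\<tau> i<..\<tau> (Suc i)} (r (Suc l))) \<in> borel_measurable (F (r l))"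
      if "i < k" for i
    \<comment> \<open>Predictability: a cell on which \<open>\<xi>\<^sub>i\<close> is active lies to the right of \<open>\<tau>\<^sub>i\<close>.\<close>
    proof (cases "\<tau> i \<le> r l")
      case True
      then show ?thesis
        using \<open>i < k\<close> \<open>l < m\<close> by (intro borel_measurable_times borel_measurable_const
          measurable_F_mono[OF \<tau>(1) r _ \<xi>]) auto
    next
      case False
      then show ?thesis
        using grid_point_cases[OF \<tau>r, of i l] \<open>i < k\<close> \<open>l < m\<close> by simp
    qed
    then show ?thesis
      unfolding \<eta>_def simple_value_def
      by (intro borel_measurable_times[OF borel_measurable_const borel_measurable_sum])
        (simp only: lessThan_iff)
  qed
  define L where "L = (\<lambda>j \<omega>. \<Sum>i<j. \<eta> i \<omega> * (B (r (Suc i)) \<omega> - B (r i) \<omega>)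
                            - (\<eta> i \<omega>)\<^sup>2 * (r (Suc i) - r i) / 2)"
  have L: "L j \<omega> = a * simple_integral B k \<tau> \<xi> (r j) \<omega>
        - a\<^sup>2 / 2 * (LINT s:{0..r j}|lborel. (simple_value k \<tau> \<xi> s \<omega>)\<^sup>2)" if "j \<le> m" for j \<omega>
  proof -
    have "simple_integral B k \<tau> \<xi> (r j) \<omega>
        = (\<Sum>l<j. simple_value k \<tau> \<xi> (r (Suc l)) \<omega> * (B (r (Suc l)) \<omega> - B (r l) \<omega>))"
      using that by (intro simple_integral_grid \<tau>r \<tau>(2))
    moreover have "(LINT s:{0..r j}|lborel. (simple_value k \<tau> \<xi> s \<omega>)\<^sup>2)
        = (\<Sum>l<j. (simple_value k \<tau> \<xi> (r (Suc l)) \<omega>)\<^sup>2 * (r (Suc l) - r l))"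
      using that by (intro simple_value_square_integral \<tau>r r0)
    ultimately show ?thesis
      by (simp add: L_def \<eta>_def sum_subtractf sum_distrib_left sum_divide_distrib mult_ac power_mult_distrib)
  qed
  show ?thesis
  proof (rule that)
    show "{\<omega>\<in>space M. \<exists>j\<le>m. c \<le> L j \<omega>} \<in> events"
      "prob {\<omega>\<in>space M. \<exists>j\<le>m. c \<le> L j \<omega>} \<le> exp (- c)"
      unfolding L_def by (intro grid_maximal_inequality r grid_less \<eta>; simp)+
    show "{\<omega>\<in>space M. \<exists>t\<in>S. c \<le> a * simple_integral B k \<tau> \<xi> t \<omega>
        - a\<^sup>2 / 2 * (LINT s:{0..t}|lborel. (simple_value k \<tau> \<xi> s \<omega>)\<^sup>2)}
      \<subseteq> {\<omega>\<in>space M. \<exists>j\<le>m. c \<le> L j \<omega>}"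
    proof safe
      fix \<omega> t
      assume "t \<in> S" and c: "c \<le> a * simple_integral B k \<tau> \<xi> t \<omega>
        - a\<^sup>2 / 2 * (LINT s:{0..t}|lborel. (simple_value k \<tau> \<xi> s \<omega>)\<^sup>2)"
      then have "t \<in> r ` {..m}"
        by (auto simp: img G_def)
      then obtain j where "j \<le> m" "t = r j"
        by auto
      then show "\<exists>j\<le>m. c \<le> L j \<omega>"
        using c L by auto
    qed
  qed
qed

end

section \<open>The maximal inequality for Ito integrals\<close>

lemma set_integrable_simple_value_power2:
  "set_integrable lborel {0..t} (\<lambda>s. (simple_value k \<tau> \<xi> s \<omega>)\<^sup>2)"
  unfolding set_integrable_def
proof (rule integrableI_bounded_set_indicator[where B = "(\<Sum>i<k. \<bar>\<xi> i \<omega>\<bar>)\<^sup>2"])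
  show "(\<lambda>s. (simple_value k \<tau> \<xi> s \<omega>)\<^sup>2) \<in> borel_measurable lborel"
    unfolding simple_value_def by measurable
  have "\<bar>simple_value k \<tau> \<xi> s \<omega>\<bar> \<le> (\<Sum>i<k. \<bar>\<xi> i \<omega>\<bar>)" for s
    unfolding simple_value_def by (rule order_trans[OF sum_abs]) (auto intro!: sum_mono simp: indicator_def)
  then have "(simple_value k \<tau> \<xi> s \<omega>)\<^sup>2 \<le> (\<Sum>i<k. \<bar>\<xi> i \<omega>\<bar>)\<^sup>2" for s
    by (metis abs_ge_zero power2_abs power_mono)
  then show "AE s in lborel. s \<in> {0..t} \<longrightarrow> norm ((simple_value k \<tau> \<xi> s \<omega>)\<^sup>2) \<le> (\<Sum>i<k. \<bar>\<xi> i \<omega>\<bar>)\<^sup>2"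
    by simp
qed (auto simp: emeasure_lborel_Icc_eq)

text \<open>From \<open>(x + y)\<^sup>2 \<le> 2 x\<^sup>2 + 2 y\<^sup>2\<close>. Convergence of simple processes to the integrand thereby
  controls their energy from above.\<close>

lemma set_integral_power2_le:
  fixes f h :: "real \<Rightarrow> real"
  assumes f: "set_integrable M A (\<lambda>s. (f s)\<^sup>2)" and h: "set_integrable M A (\<lambda>s. (h s)\<^sup>2)"
    and diff: "set_borel_measurable M A (\<lambda>s. (f s - h s)\<^sup>2)"
  shows "(LINT s:A|M. (f s)\<^sup>2) \<le> 2 * (LINT s:A|M. (h s)\<^sup>2) + 2 * (LINT s:A|M. (f s - h s)\<^sup>2)"
proof -
  have sq: "0 \<le> (x + y)\<^sup>2" "0 \<le> (x - 2 * y)\<^sup>2" for x y :: real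
    by simp_all
  have "set_integrable M A (\<lambda>s. 2 * (f s)\<^sup>2 + 2 * (h s)\<^sup>2)"
    using f h by (intro set_integral_add set_integrable_mult_right) auto
  then have d: "set_integrable M A (\<lambda>s. (f s - h s)\<^sup>2)"
  proof (rule set_integrable_bound[OF _ diff])
    have "(f s - h s)\<^sup>2 \<le> 2 * (f s)\<^sup>2 + 2 * (h s)\<^sup>2" for s
      using sq(1)[of "f s" "h s"] by (simp add: power2_eq_square algebra_simps)
    then show "AE s in M. s \<in> A \<longrightarrow> norm ((f s - h s)\<^sup>2) \<le> norm (2 * (f s)\<^sup>2 + 2 * (h s)\<^sup>2)"
      by (auto intro: order_trans)
  qed
  have "(LINT s:A|M. (f s)\<^sup>2) \<le> (LINT s:A|M. 2 * (h s)\<^sup>2 + 2 * (f s - h s)\<^sup>2)"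
  proof (rule set_integral_mono[OF f])
    show "(f s)\<^sup>2 \<le> 2 * (h s)\<^sup>2 + 2 * (f s - h s)\<^sup>2" for s
      using sq(2)[of "f s" "h s"] by (simp add: power2_eq_square algebra_simps)
  qed (use h d in \<open>auto intro!: set_integral_add set_integrable_mult_right\<close>)
  also have "\<dots> = 2 * (LINT s:A|M. (h s)\<^sup>2) + 2 * (LINT s:A|M. (f s - h s)\<^sup>2)"
    using h d by simp
  finally show ?thesis .
qed

context wiener_basis
begin

text \<open>Progressive measurability lives on \<open>[0,t]\<close> with the \<open>\<sigma>\<close>-algebra \<open>F\<^sub>t\<close>; extending by 0 makes the
  theorems on product measures applicable.\<close>

lemma progressive_indicator_measurable:
  assumes H: "progressive T F H" and t: "t \<in> time_set T"
  shows "(\<lambda>(s, \<omega>). indicator {0..t} s * H s \<omega> :: real) \<in> borel_measurable (lborel \<Otimes>\<^sub>M M)"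
proof -
  let ?P = "lborel \<Otimes>\<^sub>M M :: (real \<times> 'a) measure"
  let ?\<Omega> = "{0..t} \<times> space M"
  have "(\<lambda>p. (fst p, snd p)) \<in> measurable (restrict_space ?P ?\<Omega>) (restrict_space borel {0..t} \<Otimes>\<^sub>M F t)"
  proof (rule measurable_Pair)
    show "fst \<in> measurable (restrict_space ?P ?\<Omega>) (restrict_space borel {0..t})"
      by (intro measurable_restrict_space2 measurable_restrict_space1)
        (auto simp: space_restrict_space)
    have "snd \<in> measurable ?P (F t)"
      using measurable_compose[OF measurable_snd measurable_F_M[OF t measurable_ident_sets[OF refl]]] .
    then show "snd \<in> measurable (restrict_space ?P ?\<Omega>) (F t)"
      by (rule measurable_restrict_space1)
  qed
  moreover have "(\<lambda>(s, \<omega>). H s \<omega>) \<in> borel_measurable (restrict_space borel {0..t} \<Otimes>\<^sub>M F t)"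
    using H t unfolding progressive_def by (rule bspec)
  ultimately have "(\<lambda>p. case (fst p, snd p) of (s, \<omega>) \<Rightarrow> H s \<omega>) \<in> borel_measurable (restrict_space ?P ?\<Omega>)"
    by (rule measurable_compose)
  then have "(\<lambda>p. H (fst p) (snd p)) \<in> borel_measurable (restrict_space ?P ?\<Omega>)"
    unfolding split_conv .
  then have "(\<lambda>p. indicator ?\<Omega> p *\<^sub>R H (fst p) (snd p)) \<in> borel_measurable ?P"
    by (subst (asm) borel_measurable_restrict_space_iff) (auto simp: space_pair_measure intro: sets.Int)
  then show ?thesis
    by (rule measurable_cong[THEN iffD1, rotated])
      (auto simp: space_pair_measure indicator_def)
qed

lemma ito_integrand_section_measurable:
  assumes H: "progressive T F H" and t: "t \<in> time_set T" and \<omega>: "\<omega> \<in> space M"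
  shows "set_borel_measurable lborel {0..t} (\<lambda>s. H s \<omega>)"
  using measurable_compose[OF measurable_Pair2'[OF \<omega>] progressive_indicator_measurable[OF H t]]
  by (simp add: set_borel_measurable_def)

lemma ito_energy_measurable:
  assumes H: "progressive T F H" and t: "t \<in> time_set T"
  shows "(\<lambda>\<omega>. LINT s:{0..t}|lborel. (H s \<omega>)\<^sup>2) \<in> borel_measurable M"
proof -
  have "(\<lambda>(\<omega>, s). (indicator {0..t} s * H s \<omega>)\<^sup>2) \<in> borel_measurable (M \<Otimes>\<^sub>M lborel)"
    using borel_measurable_power[OF measurable_compose[OF measurable_pair_swap'
      progressive_indicator_measurable[OF H t]], of 2]
    by (simp add: case_prod_unfold)
  moreover have "(indicator {0..t} s * H s \<omega>)\<^sup>2 = indicator {0..t} s *\<^sub>R (H s \<omega>)\<^sup>2" for s \<omega>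
    by (simp add: indicator_def)
  ultimately show ?thesis
    using lborel.borel_measurable_lebesgue_integral[of "\<lambda>\<omega> s. (indicator {0..t} s * H s \<omega>)\<^sup>2" M]
    by (simp add: set_lebesgue_integral_def)
qed

text \<open>Outside events of vanishing probability, an approximating simple integral is within \<open>d\<close> of \<open>I\<close>
  and its energy is at most twice that of \<open>H\<close> plus \<open>2 d\<close>. The price for this crude comparison is
  the coefficient \<open>a\<^sup>2\<close> instead of the sharp \<open>a\<^sup>2 / 2\<close> and the constant 1 in the exponent. Neither
  matters for the strong law, where only the quadratic order in \<open>a\<close> counts, and in exchange convergence
  in probability suffices, without a subsequence that converges almost surely.\<close>

lemma ito_integral_maximal_inequality:
  assumes ito: "ito_integral M T F B H I" and S: "finite S" "S \<subseteq> time_set T"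
  shows "prob {\<omega>\<in>space M. \<exists>t\<in>S. c \<le> a * I t \<omega> - a\<^sup>2 * (LINT s:{0..t}|lborel. (H s \<omega>)\<^sup>2)} \<le> exp (1 - c)"
    (is "prob ?E \<le> _")
proof -
  obtain k \<tau> \<xi> where simple: "\<And>n. simple_process M T F (k n) (\<tau> n) (\<xi> n)"
    and conv: "\<And>t. t \<in> time_set T \<Longrightarrow> tendsto_in_prob M
             (\<lambda>n \<omega>. LINT s:{0..t}|lborel. (simple_value (k n) (\<tau> n) (\<xi> n) s \<omega> - H s \<omega>)\<^sup>2) (\<lambda>\<omega>. 0)"
      "\<And>t. t \<in> time_set T \<Longrightarrow> tendsto_in_prob M (\<lambda>n. simple_integral B (k n) (\<tau> n) (\<xi> n) t) (I t)"
    using ito unfolding ito_integral_def by blast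
  have H: "progressive T F H"
    and int: "\<And>t. t \<in> time_set T \<Longrightarrow> AE \<omega> in M. set_integrable lborel {0..t} (\<lambda>s. (H s \<omega>)\<^sup>2)"
    using ito by (auto simp: ito_integral_def)
  \<comment> \<open>A closeness \<open>d\<close> for which the total error \<open>d |a| + d a\<^sup>2\<close> does not exceed 1.\<close>
  define d where "d = 1 / (1 + \<bar>a\<bar> + a\<^sup>2)"
  have pos: "0 < 1 + \<bar>a\<bar> + a\<^sup>2"
    by (intro add_pos_nonneg) auto
  then have d: "0 < d" "d * \<bar>a\<bar> + d * a\<^sup>2 \<le> 1"
    by (auto simp: d_def divide_simps)
  define P where "P = (\<lambda>n t. {\<omega>\<in>space M. \<bar>simple_integral B (k n) (\<tau> n) (\<xi> n) t \<omega> - I t \<omega>\<bar> > d})"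
  define Q where "Q = (\<lambda>n t. {\<omega>\<in>space M.
    \<bar>(LINT s:{0..t}|lborel. (simple_value (k n) (\<tau> n) (\<xi> n) s \<omega> - H s \<omega>)\<^sup>2) - 0\<bar> > d})"
  have P: "P n t \<in> events" "(\<lambda>n. prob (P n t)) \<longlonglongrightarrow> 0"
    and Q: "Q n t \<in> events" "(\<lambda>n. prob (Q n t)) \<longlonglongrightarrow> 0" if "t \<in> S" for n t
  proof -
    have t: "t \<in> time_set T"
      using S that by auto
    note c = conv(1)[OF t, unfolded tendsto_in_prob_def] conv(2)[OF t, unfolded tendsto_in_prob_def]
    show "(\<lambda>n. prob (P n t)) \<longlonglongrightarrow> 0" "(\<lambda>n. prob (Q n t)) \<longlonglongrightarrow> 0"
      using c d unfolding P_def Q_def by blast+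
    have [measurable]: "simple_integral B (k n) (\<tau> n) (\<xi> n) t \<in> borel_measurable M" "I t \<in> borel_measurable M"
      "(\<lambda>\<omega>. LINT s:{0..t}|lborel. (simple_value (k n) (\<tau> n) (\<xi> n) s \<omega> - H s \<omega>)\<^sup>2) \<in> borel_measurable M"
      using c by auto
    show "P n t \<in> events" "Q n t \<in> events"
      unfolding P_def Q_def by measurable
  qed
  have bound: "prob ?E \<le> exp (1 - c) + (\<Sum>t\<in>S. prob (P n t) + prob (Q n t))" for n
  proof -
    let ?f = "\<lambda>s \<omega>. simple_value (k n) (\<tau> n) (\<xi> n) s \<omega>"
    let ?J = "\<lambda>t \<omega>. simple_integral B (k n) (\<tau> n) (\<xi> n) t \<omega>"
    obtain E where E: "E \<in> events" "prob E \<le> exp (- (c - 1))"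
      "{\<omega>\<in>space M. \<exists>t\<in>S. c - 1 \<le> a * ?J t \<omega> - a\<^sup>2 / 2 * (LINT s:{0..t}|lborel. (?f s \<omega>)\<^sup>2)} \<subseteq> E"
      by (rule simple_integral_maximal_inequality[OF simple S])
    have PQ: "(\<Union>t\<in>S. P n t \<union> Q n t) \<in> events"
      using P Q S by (intro sets.finite_UN) auto
    have key: "\<omega> \<in> E \<union> (\<Union>t\<in>S. P n t \<union> Q n t)"
      if h: "\<forall>t\<in>S. set_integrable lborel {0..t} (\<lambda>s. (H s \<omega>)\<^sup>2)" and "\<omega> \<in> ?E" for \<omega>
    proof (rule ccontr)
      assume n: "\<omega> \<notin> E \<union> (\<Union>t\<in>S. P n t \<union> Q n t)"
      obtain t where \<omega>: "\<omega> \<in> space M" and t: "t \<in> S"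
        and c: "c \<le> a * I t \<omega> - a\<^sup>2 * (LINT s:{0..t}|lborel. (H s \<omega>)\<^sup>2)"
        using \<open>\<omega> \<in> ?E\<close> by auto
      have tT: "t \<in> time_set T"
        using t S by auto
      let ?D = "LINT s:{0..t}|lborel. (?f s \<omega> - H s \<omega>)\<^sup>2"
      have near: "\<bar>?J t \<omega> - I t \<omega>\<bar> \<le> d" "?D \<le> d"
        using n t \<omega> by (auto simp: P_def Q_def not_less)
      have "set_borel_measurable lborel {0..t} (\<lambda>s. (?f s \<omega> - H s \<omega>)\<^sup>2)"
      proof -
        have [measurable]: "(\<lambda>s. indicator {0..t} s * H s \<omega>) \<in> borel_measurable borel"
          using ito_integrand_section_measurable[OF H tT \<omega>] by (simp add: set_borel_measurable_def)
        \<comment> \<open>The path of \<open>H\<close> is measurable only on \<open>[0,t]\<close>, hence the additional indicator.\<close>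
        have "(\<lambda>s. indicator {0..t} s * (?f s \<omega> - indicator {0..t} s * H s \<omega>)\<^sup>2) \<in> borel_measurable borel"
          unfolding simple_value_def by measurable
        also have "(\<lambda>s. indicator {0..t} s * (?f s \<omega> - indicator {0..t} s * H s \<omega>)\<^sup>2)
          = (\<lambda>s. indicator {0..t} s * (?f s \<omega> - H s \<omega>)\<^sup>2)"
          by (auto simp: indicator_def)
        finally show ?thesis
          by (simp add: set_borel_measurable_def)
      qed
      then have "(LINT s:{0..t}|lborel. (?f s \<omega>)\<^sup>2) \<le> 2 * (LINT s:{0..t}|lborel. (H s \<omega>)\<^sup>2) + 2 * ?D"
        using h t by (intro set_integral_power2_le set_integrable_simple_value_power2) auto
      with near have "(LINT s:{0..t}|lborel. (?f s \<omega>)\<^sup>2) \<le> 2 * (LINT s:{0..t}|lborel. (H s \<omega>)\<^sup>2) + 2 * d"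
        by simp
      from mult_left_mono[OF this, of "a\<^sup>2 / 2"]
      have "a\<^sup>2 / 2 * (LINT s:{0..t}|lborel. (?f s \<omega>)\<^sup>2) \<le> a\<^sup>2 * (LINT s:{0..t}|lborel. (H s \<omega>)\<^sup>2) + d * a\<^sup>2"
        by (simp add: algebra_simps)
      moreover have "\<bar>a * (I t \<omega> - ?J t \<omega>)\<bar> \<le> d * \<bar>a\<bar>"
        using mult_left_mono[OF near(1) abs_ge_zero[of a]] by (simp add: abs_mult abs_minus_commute mult.commute)
      then have "a * I t \<omega> \<le> a * ?J t \<omega> + d * \<bar>a\<bar>"
        by (simp add: right_diff_distrib)
      ultimately have "c - 1 \<le> a * ?J t \<omega> - a\<^sup>2 / 2 * (LINT s:{0..t}|lborel. (?f s \<omega>)\<^sup>2)"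
        using c d(2) by linarith
      then have "\<omega> \<in> E"
        using E(3) t \<omega> by blast
      then show False
        using n by simp
    qed
    have "AE \<omega> in M. \<forall>t\<in>S. set_integrable lborel {0..t} (\<lambda>s. (H s \<omega>)\<^sup>2)"
      using S int by (intro AE_finite_allI) auto
    then have "AE \<omega> in M. \<omega> \<in> ?E \<longrightarrow> \<omega> \<in> E \<union> (\<Union>t\<in>S. P n t \<union> Q n t)"
      by (rule eventually_mono) (intro impI key)
    then have "prob ?E \<le> prob (E \<union> (\<Union>t\<in>S. P n t \<union> Q n t))"
      using E(1) PQ by (intro finite_measure_mono_AE) auto
    also have "\<dots> \<le> prob E + prob (\<Union>t\<in>S. P n t \<union> Q n t)"
      using E(1) PQ by (rule measure_Un_le)
    also have "prob (\<Union>t\<in>S. P n t \<union> Q n t) \<le> (\<Sum>t\<in>S. prob (P n t \<union> Q n t))"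
      using S P Q by (intro finite_measure_subadditive_finite) auto
    also have "\<dots> \<le> (\<Sum>t\<in>S. prob (P n t) + prob (Q n t))"
      using P Q by (intro sum_mono measure_Un_le) auto
    finally show ?thesis
      using E(2) by simp
  qed
  have "(\<lambda>n. exp (1 - c) + (\<Sum>t\<in>S. prob (P n t) + prob (Q n t))) \<longlonglongrightarrow> exp (1 - c) + (\<Sum>t\<in>S. 0 + 0)"
    by (intro tendsto_intros P Q)
  then show ?thesis
    using bound by (intro LIMSEQ_le_const) auto
qed

end

section \<open>The strong law of large numbers and the estimator\<close>

lemma arg_max_concave_quadratic:
  fixes p q :: real
  assumes "0 < q"
  shows "arg_max (\<lambda>\<theta>. \<theta> * p - \<theta>\<^sup>2 / 2 * q) (\<lambda>\<theta>. True) = p / q"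
proof -
  let ?f = "\<lambda>\<theta>. \<theta> * p - \<theta>\<^sup>2 / 2 * q"
  have f: "?f (p / q) - ?f \<theta> = q / 2 * (\<theta> - p / q)\<^sup>2" for \<theta>
    using assms by (simp add: field_simps power2_eq_square)
  have "?f (arg_max ?f (\<lambda>\<theta>. True)) = ?f (p / q)"
  proof (rule arg_max_equality)
    show "?f \<theta> \<le> ?f (p / q)" for \<theta>
      using f[of \<theta>] assms zero_le_power2[of "\<theta> - p / q"]
      by (smt (verit) divide_nonneg_pos mult_nonneg_nonneg)
  qed simp
  then show ?thesis
    using f[of "arg_max ?f (\<lambda>\<theta>. True)"] assms by simp
qed

context wiener_basis
begin

text \<open>The maximal inequality does not depend on the number of observation times, so it passes to all rational
  times at once, and letting the level tend to infinity shows that the supremum is finite almost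
  surely. Irrational times follow from continuity of \<open>I\<close>: rational times approach \<open>t\<close> from below,
  where monotonicity bounds the energy by its value at \<open>t\<close>.\<close>

lemma ito_integral_AE_bound:
  assumes ito: "ito_integral M T F B H I"
  shows "AE \<omega> in M. \<exists>c. \<forall>t\<in>time_set T. a * I t \<omega> \<le> c + a\<^sup>2 * (LINT s:{0..t}|lborel. (H s \<omega>)\<^sup>2)"
proof -
  define A where "A = (\<lambda>t \<omega>. LINT s:{0..t}|lborel. (H s \<omega>)\<^sup>2)"
  define D where "D = time_set T \<inter> \<rat>"
  define S where "S = (\<lambda>m::nat. D \<inter> from_nat_into \<rat> ` {..m})"
  define N where "N = (\<lambda>c. {\<omega>\<in>space M. \<exists>t\<in>D. c \<le> a * I t \<omega> - a\<^sup>2 * A t \<omega>})"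
  have "\<exists>m. x \<in> S m" if "x \<in> D" for x
  proof -
    have "x \<in> \<rat>"
      using that by (simp add: D_def)
    then obtain m where "x = from_nat_into \<rat> m"
      using from_nat_into_surj[OF countable_rat, of x] by auto
    then show ?thesis
      using that by (auto simp: S_def)
  qed
  then have S: "(\<Union>m. S m) = D" "finite (S m)" "S m \<subseteq> time_set T" for m
    by (auto simp: S_def D_def)
  have D: "countable D"
    unfolding D_def by (rule countable_subset[OF _ countable_rat]) auto
  have H: "progressive T F H" and cont: "continuous_process M T I"
    and int: "\<And>t. t \<in> time_set T \<Longrightarrow> AE \<omega> in M. set_integrable lborel {0..t} (\<lambda>s. (H s \<omega>)\<^sup>2)"
    and I: "\<And>t. t \<in> time_set T \<Longrightarrow> I t \<in> borel_measurable M"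
    using ito by (auto simp: ito_integral_def adapted_def intro: measurable_F_M)
  have meas: "{\<omega>\<in>space M. c \<le> a * I t \<omega> - a\<^sup>2 * A t \<omega>} \<in> events" if "t \<in> time_set T" for c t
  proof -
    have [measurable]: "I t \<in> borel_measurable M" "A t \<in> borel_measurable M"
      unfolding A_def using I ito_energy_measurable[OF H] that by auto
    show ?thesis by measurable
  qed
  have N_meas: "N c \<in> events" for c
  proof -
    have "N c = (\<Union>t\<in>D. {\<omega>\<in>space M. c \<le> a * I t \<omega> - a\<^sup>2 * A t \<omega>})"
      by (auto simp: N_def)
    also have "\<dots> \<in> events"
      using D by (intro sets.countable_UN'' meas) (auto simp: D_def)
    finally show ?thesis .
  qed
  have N_le: "prob (N c) \<le> exp (1 - c)" for c
  proof -
    define E where "E = (\<lambda>m. {\<omega>\<in>space M. \<exists>t\<in>S m. c \<le> a * I t \<omega> - a\<^sup>2 * A t \<omega>})"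
    have "E m \<in> events" for m
    proof -
      have "E m = (\<Union>t\<in>S m. {\<omega>\<in>space M. c \<le> a * I t \<omega> - a\<^sup>2 * A t \<omega>})"
        by (auto simp: E_def)
      also have "\<dots> \<in> events"
        by (rule sets.finite_UN[OF S(2)]) (rule meas[OF subsetD[OF S(3)]])
      finally show ?thesis .
    qed
    then have "range E \<subseteq> events"
      by (rule image_subsetI)
    moreover have "incseq E"
      by (rule incseq_SucI) (auto simp: E_def S_def)
    ultimately have "(\<lambda>m. prob (E m)) \<longlonglongrightarrow> prob (\<Union>m. E m)"
      by (rule finite_Lim_measure_incseq)
    moreover have "(\<Union>m. E m) = N c"
      unfolding E_def N_def S(1)[symmetric] by blast
    ultimately have lim: "(\<lambda>m. prob (E m)) \<longlonglongrightarrow> prob (N c)"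
      by simp
    have "prob (E m) \<le> exp (1 - c)" for m
      unfolding E_def A_def by (rule ito_integral_maximal_inequality[OF ito S(2,3)])
    then show ?thesis
      by (intro LIMSEQ_le_const2[OF lim] exI[of _ 0] allI impI)
  qed
  \<comment> \<open>The summand 1 in the level cancels the constant in the maximal inequality, which leaves
      \<open>exp (- n) \<le> 1 / (n + 1)\<close>.\<close>
  have "prob (\<Inter>n::nat. N (1 + real n)) \<le> inverse (real (Suc n))" for n
  proof -
    have "prob (\<Inter>n::nat. N (1 + real n)) \<le> prob (N (1 + real n))"
      using N_meas by (intro finite_measure_mono) auto
    also have "\<dots> \<le> inverse (exp (real n))"
      using N_le[of "1 + real n"] by (simp add: exp_minus)
    also have "\<dots> \<le> inverse (real (Suc n))"
      using exp_ge_add_one_self[of "real n"] by (intro le_imp_inverse_le) auto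
    finally show ?thesis .
  qed
  then have "prob (\<Inter>n::nat. N (1 + real n)) \<le> 0"
    by (intro LIMSEQ_le_const[OF LIMSEQ_inverse_real_of_nat]) auto
  then have "prob (\<Inter>n::nat. N (1 + real n)) = 0"
    using measure_nonneg[of M] by (intro antisym)
  then have "(\<Inter>n::nat. N (1 + real n)) \<in> null_sets M"
    using N_meas by (auto simp: null_sets_def emeasure_eq_measure)
  then have AE_N: "AE \<omega> in M. \<omega> \<notin> (\<Inter>n::nat. N (1 + real n))"
    by (rule AE_not_in)
  have "AE \<omega> in M. \<forall>t\<in>D. set_integrable lborel {0..t} (\<lambda>s. (H s \<omega>)\<^sup>2)"
    using D int by (subst AE_ball_countable) (auto simp: D_def)
  with AE_N AE_space show ?thesis
  proof eventually_elim
    case (elim \<omega>)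
    then have \<omega>: "\<omega> \<in> space M" by simp
    obtain n :: nat where n: "\<omega> \<notin> N (1 + real n)"
      using elim(1) by blast
    \<comment> \<open>Integrability for all times simultaneously: \<open>[0,T)\<close> is open on the right, so there is a
        rational time after \<open>t\<close>.\<close>
    have int\<omega>: "set_integrable lborel {0..t} (\<lambda>s. (H s \<omega>)\<^sup>2)" if "t \<in> time_set T" for t
    proof -
      have "ereal t < T"
        using that by (simp add: time_set_def)
      then obtain z where z: "ereal t < ereal z" "ereal z < T"
        using ereal_dense2 by blast
      then obtain q where "q \<in> \<rat>" "t < q" "q < z"
        using Rats_dense_in_real[of t z] by auto
      then have "ereal q < T" "q \<in> \<rat>" "t \<le> q"
        using z less_trans[of "ereal q" "ereal z" T] by simp_all
      then have "q \<in> D" "t \<le> q"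
        using that by (simp_all add: D_def time_set_def)
      then show ?thesis
        by (intro set_integrable_subset[OF bspec[OF elim(3)]]) auto
    qed
    have A_mono: "A s \<omega> \<le> A t \<omega>" if "s \<le> t" "t \<in> time_set T" "s \<in> time_set T" for s t
      unfolding A_def set_lebesgue_integral_def
    proof (rule integral_mono)
      show "indicator {0..s} x *\<^sub>R (H x \<omega>)\<^sup>2 \<le> indicator {0..t} x *\<^sub>R (H x \<omega>)\<^sup>2" for x
        using that(1) by (simp add: indicator_def)
    qed (use int\<omega> that(2,3) in \<open>simp_all add: set_integrable_def\<close>)
    have "a * I t \<omega> \<le> (1 + real n) + a\<^sup>2 * A t \<omega>" if t: "t \<in> time_set T" for t
    proof (rule ccontr)
      assume "\<not> ?thesis"
      then have e: "0 < a * I t \<omega> - ((1 + real n) + a\<^sup>2 * A t \<omega>)" (is "0 < ?e")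
        by simp
      have "continuous_on (time_set T) (\<lambda>s. a * I s \<omega>)"
        using cont \<omega> unfolding continuous_process_def by (intro continuous_on_mult_left) blast
      then obtain d where d: "0 < d"
        "\<And>s. s \<in> time_set T \<Longrightarrow> dist s t < d \<Longrightarrow> dist (a * I s \<omega>) (a * I t \<omega>) < ?e"
        using t e unfolding continuous_on_iff by meson
      obtain q where q: "q \<in> \<rat>" "0 \<le> q" "q \<le> t" "dist q t < d"
      proof (cases "t = 0")
        case True
        then show ?thesis
          using d(1) by (intro that[of 0]) simp_all
      next
        case False
        then have "max 0 (t - d) < t"
          using t d(1) by (simp add: time_set_def)
        then obtain q where "q \<in> \<rat>" "max 0 (t - d) < q" "q < t"
          using Rats_dense_in_real by blast
        then show ?thesis
          by (intro that[of q]) (simp_all add: dist_real_def)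
      qed
      have qT: "q \<in> time_set T"
        using time_set_downward[OF t q(2,3)] .
      have "(1 + real n) + a\<^sup>2 * A t \<omega> < a * I q \<omega>"
        using d(2)[OF qT q(4)] by (simp add: dist_real_def abs_less_iff)
      moreover have "a\<^sup>2 * A q \<omega> \<le> a\<^sup>2 * A t \<omega>"
        using A_mono[OF q(3) t qT] by (intro mult_left_mono) auto
      ultimately have "1 + real n \<le> a * I q \<omega> - a\<^sup>2 * A q \<omega>"
        by simp
      then show False
        using n \<omega> q(1) qT unfolding N_def D_def by blast
    qed
    then show ?case
      by (auto simp: A_def)
  qed
qed

text \<open>Divide \<open>\<plusminus> a I\<^sub>t \<le> c + a\<^sup>2 A\<^sub>t\<close> by \<open>a A\<^sub>t\<close>: where \<open>A\<close> tends to infinity, the upper limit of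
  \<open>|I\<^sub>t / A\<^sub>t|\<close> is at most \<open>a\<close>. The exceptional set must not depend on \<open>a\<close>, so \<open>a\<close> ranges over a
  sequence tending to 0. The quantification over filters is inside the almost sure statement because
  it covers every mode of convergence of \<open>t\<close> with the same exceptional set.\<close>

theorem ito_integral_strong_law:
  assumes ito: "ito_integral M T F B H I"
  defines "A \<equiv> \<lambda>t \<omega>. LINT s:{0..t}|lborel. (H s \<omega>)\<^sup>2"
  shows "AE \<omega> in M. \<forall>G. (\<forall>\<^sub>F t in G. t \<in> time_set T) \<longrightarrow> filterlim (\<lambda>t. A t \<omega>) at_top G
    \<longrightarrow> ((\<lambda>t. I t \<omega> / A t \<omega>) \<longlongrightarrow> 0) G"
proof -
  have "AE \<omega> in M. \<forall>n. \<exists>c. \<forall>t\<in>time_set T.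
      inverse (real (Suc n)) * I t \<omega> \<le> c + (inverse (real (Suc n)))\<^sup>2 * A t \<omega>"
    unfolding AE_all_countable A_def by (intro allI ito_integral_AE_bound ito)
  moreover have "AE \<omega> in M. \<forall>n. \<exists>c. \<forall>t\<in>time_set T.
      - inverse (real (Suc n)) * I t \<omega> \<le> c + (- inverse (real (Suc n)))\<^sup>2 * A t \<omega>"
    unfolding AE_all_countable A_def by (intro allI ito_integral_AE_bound ito)
  ultimately show ?thesis
  proof (eventually_elim, intro allI impI tendstoI)
    fix \<omega> and G :: "real filter" and \<epsilon> :: real
    assume up: "\<forall>n. \<exists>c. \<forall>t\<in>time_set T.
        inverse (real (Suc n)) * I t \<omega> \<le> c + (inverse (real (Suc n)))\<^sup>2 * A t \<omega>"
      and lo: "\<forall>n. \<exists>c. \<forall>t\<in>time_set T.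
        - inverse (real (Suc n)) * I t \<omega> \<le> c + (- inverse (real (Suc n)))\<^sup>2 * A t \<omega>"
      and time: "\<forall>\<^sub>F t in G. t \<in> time_set T" and A: "filterlim (\<lambda>t. A t \<omega>) at_top G"
      and \<epsilon>: "0 < \<epsilon>"
    obtain n where n: "inverse (real (Suc n)) < \<epsilon> / 2"
      using reals_Archimedean[of "\<epsilon> / 2"] \<epsilon> by auto
    define a where "a = inverse (real (Suc n))"
    have a: "0 < a" "a < \<epsilon> / 2"
      using n by (auto simp: a_def)
    obtain c1 where c1: "\<And>t. t \<in> time_set T \<Longrightarrow> a * I t \<omega> \<le> c1 + a\<^sup>2 * A t \<omega>"
      using up unfolding a_def by blast
    obtain c2 where c2: "\<And>t. t \<in> time_set T \<Longrightarrow> - a * I t \<omega> \<le> c2 + (- a)\<^sup>2 * A t \<omega>"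
      using lo unfolding a_def by blast
    define c where "c = max \<bar>c1\<bar> \<bar>c2\<bar>"
    have "\<forall>\<^sub>F t in G. max 0 (2 * c / (a * \<epsilon>)) < A t \<omega>"
      using A unfolding filterlim_at_top_dense by (rule spec)
    with time show "\<forall>\<^sub>F t in G. dist (I t \<omega> / A t \<omega>) 0 < \<epsilon>"
    proof eventually_elim
      case (elim t)
      then have pos: "0 < A t \<omega>" and "2 * c / (a * \<epsilon>) < A t \<omega>"
        by auto
      then have "2 * c < a * \<epsilon> * A t \<omega>"
        using a(1) \<epsilon> by (simp add: field_simps)
      moreover have "a * \<bar>I t \<omega>\<bar> \<le> c + a\<^sup>2 * A t \<omega>"
        using c1[of t] c2[of t] elim(1) by (auto simp: c_def abs_if)
      moreover have "2 * (a\<^sup>2 * A t \<omega>) < a * \<epsilon> * A t \<omega>"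
        using a pos by (simp add: power2_eq_square)
      ultimately have "a * \<bar>I t \<omega>\<bar> < a * (\<epsilon> * A t \<omega>)"
        by simp
      then have "\<bar>I t \<omega>\<bar> < \<epsilon> * A t \<omega>"
        using a(1) by simp
      then show ?case
        using pos by (simp add: field_simps)
    qed
  qed
qed

end

text \<open>Inserting \<open>dX = \<alpha> b X dt + \<sigma> dB\<close>, the score \<open>J\<close> splits into \<open>\<alpha>\<close> times the information and the
  Ito integral of \<open>b X / \<sigma>\<close>, whose energy is again the information.\<close>

theorem theorem3p4:
  fixes T :: ereal and b \<sigma> :: "real \<Rightarrow> real" and \<alpha> :: real
    and M :: "'a measure" and F :: "real \<Rightarrow> 'a measure"
    and B X J :: "real \<Rightarrow> 'a \<Rightarrow> real"
  assumes "0 < T"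
    and "continuous_on (time_set T) b" and "continuous_on (time_set T) \<sigma>"
    and "\<forall>t\<in>time_set T. 0 < \<sigma> t"
    and "\<exists>t0. 0 < t0 \<and> ereal t0 < T \<and> (\<forall>t. t0 \<le> t \<and> ereal t < T \<longrightarrow> b t \<noteq> 0)"
    and "prob_space M"
    and "usual_conditions M T F"
    and "\<forall>t\<in>time_set T. sets (F t) = sets (augmented_natural_filtration M B t)"
    and "sets M = sigma_sets (space M) (\<Union>t\<in>time_set T. sets (F t))"
    and "wiener_process M T F B"
    and "strong_solution M T F B (\<lambda>t x. \<alpha> * b t * x) (\<lambda>t x. \<sigma> t) 0 X"
    and "ito_process_integral M T F B (\<lambda>s \<omega>. \<alpha> * b s * X s \<omega>) (\<lambda>s \<omega>. \<sigma> s) X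
           (\<lambda>s \<omega>. b s * X s \<omega> / (\<sigma> s)\<^sup>2) J"
    and "AE \<omega> in M. filterlim (\<lambda>t. information b \<sigma> X (real_of_ereal t) \<omega>) at_top (at_left T)"
  shows "AE \<omega> in M. ((\<lambda>t. mle b \<sigma> X J (real_of_ereal t) \<omega>) \<longlongrightarrow> \<alpha>) (at_left T)"
proof -
  interpret wiener_basis M T F B
    using assms by (auto simp: wiener_basis_def wiener_basis_axioms_def usual_conditions_def)
  let ?H = "\<lambda>s \<omega>. b s * X s \<omega> / (\<sigma> s)\<^sup>2 * \<sigma> s"
  let ?A = "information b \<sigma> X"
  obtain I where I: "ito_integral M T F B ?H I"
    and J: "AE \<omega> in M. \<forall>t\<in>time_set T. J t \<omega> = J 0 \<omega>
      + (LINT s:{0..t}|lborel. b s * X s \<omega> / (\<sigma> s)\<^sup>2 * (\<alpha> * b s * X s \<omega>)) + I t \<omega>"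
    and J0: "AE \<omega> in M. J 0 \<omega> = 0"
    using assms(12) unfolding ito_process_integral_def ito_process_def by blast
  have \<sigma>: "\<sigma> s \<noteq> 0" if "s \<in> {0..t}" "t \<in> time_set T" for s t
    using assms(4) time_set_downward[of t T s] that by fastforce
  have energy: "(LINT s:{0..t}|lborel. (?H s \<omega>)\<^sup>2) = ?A t \<omega>" if "t \<in> time_set T" for t \<omega>
    unfolding information_def using \<sigma> that
    by (intro set_lebesgue_integral_cong) (auto simp: field_simps power2_eq_square)
  have drift: "(LINT s:{0..t}|lborel. b s * X s \<omega> / (\<sigma> s)\<^sup>2 * (\<alpha> * b s * X s \<omega>)) = \<alpha> * ?A t \<omega>" for t \<omega>
    unfolding information_def set_lebesgue_integral_def integral_mult_right_zero[symmetric]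
    by (intro Bochner_Integration.integral_cong) (auto simp: power2_eq_square mult_ac)
  let ?G = "filtermap real_of_ereal (at_left T)"
  have time: "\<forall>\<^sub>F t in ?G. t \<in> time_set T"
    unfolding eventually_filtermap eventually_at_left[OF assms(1)]
  proof (intro exI[of _ 0] conjI allI impI assms(1))
    fix t :: ereal
    assume "0 < t" "t < T"
    then show "real_of_ereal t \<in> time_set T"
      by (cases t) (auto simp: time_set_def)
  qed
  show ?thesis
    using ito_integral_strong_law[OF I] J J0 assms(13)
  proof eventually_elim
    case (elim \<omega>)
    have J_eq: "J t \<omega> = \<alpha> * ?A t \<omega> + I t \<omega>" if "t \<in> time_set T" for t
      using elim(2)[unfolded drift] elim(3) that by simp
    have info: "filterlim (\<lambda>t. ?A t \<omega>) at_top ?G"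
      using elim(4) by (simp add: filterlim_filtermap)
    have eq: "\<forall>\<^sub>F t in ?G. (LINT s:{0..t}|lborel. (?H s \<omega>)\<^sup>2) = ?A t \<omega>"
      using time by eventually_elim (rule energy)
    have "filterlim (\<lambda>t. LINT s:{0..t}|lborel. (?H s \<omega>)\<^sup>2) at_top ?G"
      using info eq by (subst filterlim_cong[OF refl refl]) auto
    then have "((\<lambda>t. I t \<omega> / (LINT s:{0..t}|lborel. (?H s \<omega>)\<^sup>2)) \<longlongrightarrow> 0) ?G"
      using elim(1) time by blast
    from tendsto_add[OF tendsto_const[of \<alpha>] this]
    have "((\<lambda>t. \<alpha> + I t \<omega> / (LINT s:{0..t}|lborel. (?H s \<omega>)\<^sup>2)) \<longlongrightarrow> \<alpha>) ?G"
      by simp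
    moreover have "\<forall>\<^sub>F t in ?G. \<alpha> + I t \<omega> / (LINT s:{0..t}|lborel. (?H s \<omega>)\<^sup>2) = mle b \<sigma> X J t \<omega>"
    proof -
      have "\<forall>\<^sub>F t in ?G. 0 < ?A t \<omega>"
        using info by (simp add: filterlim_at_top_dense)
      with time eq show ?thesis
      proof eventually_elim
        case (elim t)
        have "mle b \<sigma> X J t \<omega> = J t \<omega> / ?A t \<omega>"
          unfolding mle_def log_likelihood_def using elim(3) by (rule arg_max_concave_quadratic)
        then show ?case
          using elim J_eq by (simp add: add_divide_distrib)
      qed
    qed
    ultimately have "((\<lambda>t. mle b \<sigma> X J t \<omega>) \<longlongrightarrow> \<alpha>) ?G"
      by (rule Lim_transform_eventually)
    then show ?case
      by (simp add: filterlim_filtermap)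
  qed
qed

end
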